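(* Let $\mathcal X=\prod_{i\in[n]}\mathcal X_i$ and $\mathcal Y$ be finite sets, and let $p(y|x)$ be a privacy channel from $\mathcal X$ to $\mathcal Y$. For each $i\in[n]$ let $$\mathbb Q_i=\{(\mathcal X_i,p(y|x_i),\mathcal Y): p(x_{(i)}|x_i)\in\mathbb P\}$$ be the set of all channels from $\mathcal X_i$ to $\mathcal Y$ of the form $p(y|x_i)=\sum_{x_{(i)}\in\mathcal X_{(i)}}p(y|x_i,x_{(i)})\,p(x_{(i)}|x_i)$, where $p(x_{(i)}|x_i)$ ranges over all conditional distributions arising from some $X\in\mathbb P$, and let $$\mathbb S_i=\{(\mathcal X_i,p(y|x_i),\mathcal Y): \text{for each } x_i\in\mathcal X_i \text{ there exists } x_{(i)}\in\mathcal X_{(i)} \text{ such that } p(y|x_i)=p(y|x_i,x_{(i)}) \text{ for all } y\in\mathcal Y\}.$$ Then $\mathbb S_i\subseteq\mathbb Q_i$, and each channel in $\mathbb Q_i$ is a convex combination of channels in $\mathbb S_i$. Therefore $$C_1=\max_{i\in[n],\,X\in\mathbb P}I(X_i;Y)=\max_{i\in[n]}\ \max_{p(y|x_i)\in\mathbb Q_i}\ \max_{p(x_i)\in\mathbb P_i}I(X_i;Y)=\max_{i\in[n]}\ \max_{p(y|x_i)\in\mathbb S_i}\ \max_{p(x_i)\in\mathbb P_i}I(X_i;Y),$$ where $C_1$ is the individual channel capacity of the privacy channel $p(y|x)$ with respect to $\mathbb P$.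
   Context: $n\ge1$ is an integer and $[n]=\{1,\dots,n\}$. $\mathcal X_1,\dots,\mathcal X_n$ are finite nonempty sets, $\mathcal X=\prod_{i\in[n]}\mathcal X_i$, $\mathcal X_{(i)}=\prod_{j\neq i}\mathcal X_j$; for $x=(x_1,\dots,x_n)\in\mathcal X$ write $x_{(i)}=(x_1,\dots,x_{i-1},x_{i+1},\dots,x_n)$ and identify $x$ with $(x_i,x_{(i)})$. $\mathcal Y$ is the finite range of a query function $f:\mathcal X\to\mathcal Y$. A privacy channel is a probability transition matrix $p(y|x)$, i.e. for each $x\in\mathcal X$, $p(\cdot|x)$ is a probability distribution on $\mathcal Y$. $\mathbb P$ is the set of all probability distributions on $\mathcal X$ and $\mathbb P_i$ the set of all probability distributions on $\mathcal X_i$; $X=(X_1,\dots,X_n)\in\mathbb P$ means that the random vector $X$ has distribution in $\mathbb P$. $p(x_{(i)}|x_i)\in\mathbb P$ means that there is $X\in\mathbb P$ with $X\sim p(x_i)p(x_{(i)}|x_i)$; hence $p(x_{(i)}|x_i)$ may be any probability transition matrix from $\mathcal X_i$ to $\mathcal X_{(i)}$. $Y$ is the output of the channel $p(y|x)$ on input $X$ (in the first maximum), respectively the output of the channel $p(y|x_i)$ on input $X_i\sim p(x_i)$ (in the other two). $I(\cdot;\cdot)$ is mutual information. The individual channel capacity of $p(y|x)$ with respect to $\mathbb P$ is $C_1=\max_{i\in[n],X\in\mathbb P}I(X_i;Y)$. A convex combination of channels means a convex combination of their transition matrices. *)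

theory Defs
  imports "HOL-Probability.Probability"
begin

text \<open>
  The coordinate sets are \<open>Xs i\<close> for \<open>i \<in> {1..n}\<close>; all of them are subsets of one type \<open>'a\<close>,
  which is no restriction for finitely many finite sets.  For \<open>z \<in> other_inputs n Xs i\<close> and
  \<open>a \<in> Xs i\<close> the point written $(x_i, x_{(i)})$ on paper is \<open>z(i := a)\<close>.
\<close>

definition inputs :: "nat \<Rightarrow> (nat \<Rightarrow> 'a set) \<Rightarrow> (nat \<Rightarrow> 'a) set" where
  "inputs n Xs = (\<Pi>\<^sub>E i\<in>{1..n}. Xs i)"

definition other_inputs :: "nat \<Rightarrow> (nat \<Rightarrow> 'a set) \<Rightarrow> nat \<Rightarrow> (nat \<Rightarrow> 'a) set" where
  "other_inputs n Xs i = (\<Pi>\<^sub>E j\<in>{1..n} - {i}. Xs j)"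

definition dists :: "'x set \<Rightarrow> 'x pmf set" where
  "dists A = {q. set_pmf q \<subseteq> A}"

text \<open>
  Transition matrices from \<open>A\<close> to \<open>B\<close>.  The functions are extensional, so that two channels are
  equal as soon as their transition matrices agree on \<open>A\<close>.
\<close>

definition channels :: "'x set \<Rightarrow> 'y set \<Rightarrow> ('x \<Rightarrow> 'y pmf) set" where
  "channels A B = A \<rightarrow>\<^sub>E dists B"

definition convex_combination_of ::
    "'x set \<Rightarrow> 'y set \<Rightarrow> ('x \<Rightarrow> 'y pmf) set \<Rightarrow> ('x \<Rightarrow> 'y pmf) \<Rightarrow> bool" where
  "convex_combination_of A B S W \<longleftrightarrow>
     (\<exists>T c. finite T \<and> T \<subseteq> S \<and> (\<forall>V\<in>T. 0 \<le> c V) \<and> (\<Sum>V\<in>T. c V) = (1::real) \<and>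
        (\<forall>a\<in>A. \<forall>y\<in>B. pmf (W a) y = (\<Sum>V\<in>T. c V * pmf (V a) y)))"

text \<open>
  The probability space of an input distributed as \<open>q\<close> together with the output of the channel \<open>W\<close>.
  Its carrier is the finite set \<open>A \<times> B\<close>, so input and output are the two projections.
\<close>

definition joint_space :: "'x set \<Rightarrow> 'y set \<Rightarrow> 'x pmf \<Rightarrow> ('x \<Rightarrow> 'y pmf) \<Rightarrow> ('x \<times> 'y) measure" where
  "joint_space A B q W = point_measure (A \<times> B) (\<lambda>(x, y). ennreal (pmf q x * pmf (W x) y))"

definition channel_info ::
    "real \<Rightarrow> 'x set \<Rightarrow> 'y set \<Rightarrow> 'x pmf \<Rightarrow> ('x \<Rightarrow> 'y pmf) \<Rightarrow> real" where
  "channel_info b A B q W =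
     prob_space.mutual_information (joint_space A B q W) b (count_space A) (count_space B) fst snd"

definition coord_info ::
    "real \<Rightarrow> nat \<Rightarrow> (nat \<Rightarrow> 'a set) \<Rightarrow> 'y set \<Rightarrow> ((nat \<Rightarrow> 'a) \<Rightarrow> 'y pmf)
      \<Rightarrow> nat \<Rightarrow> (nat \<Rightarrow> 'a) pmf \<Rightarrow> real" where
  "coord_info b n Xs Y p i P =
     prob_space.mutual_information (joint_space (inputs n Xs) Y P p) b
       (count_space (Xs i)) (count_space Y) (\<lambda>\<omega>. fst \<omega> i) snd"

text \<open>
  \<open>maximum A f\<close> is meaningful only if the maximum is attained, that is, if \<open>has_maximum A f\<close> holds.
\<close>

definition has_maximum :: "'c set \<Rightarrow> ('c \<Rightarrow> real) \<Rightarrow> bool" where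
  "has_maximum A f \<longleftrightarrow> (\<exists>x\<in>A. \<forall>y\<in>A. f y \<le> f x)"

definition maximum :: "'c set \<Rightarrow> ('c \<Rightarrow> real) \<Rightarrow> real" where
  "maximum A f = (GREATEST v. v \<in> f ` A)"

definition individual_capacity ::
    "real \<Rightarrow> nat \<Rightarrow> (nat \<Rightarrow> 'a set) \<Rightarrow> 'y set \<Rightarrow> ((nat \<Rightarrow> 'a) \<Rightarrow> 'y pmf) \<Rightarrow> real" where
  "individual_capacity b n Xs Y p =
     maximum ({1..n} \<times> dists (inputs n Xs)) (\<lambda>(i, P). coord_info b n Xs Y p i P)"

text \<open>
  The conditional distributions $p(x_{(i)}|x_i)$ of some random vector on the product: the vector
  with distribution \<open>P\<close> has the law $p(x_i)\,p(x_{(i)}|x_i)$ with \<open>q\<close> for $p(x_i)$ and \<open>K\<close> for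
  $p(x_{(i)}|x_i)$.  The rows of \<open>K\<close> at points of \<open>q\<close>-probability zero are arbitrary.
\<close>

definition conditionals ::
    "nat \<Rightarrow> (nat \<Rightarrow> 'a set) \<Rightarrow> nat \<Rightarrow> ('a \<Rightarrow> (nat \<Rightarrow> 'a) pmf) set" where
  "conditionals n Xs i =
     {K \<in> channels (Xs i) (other_inputs n Xs i).
        \<exists>P\<in>dists (inputs n Xs). \<exists>q\<in>dists (Xs i).
          \<forall>a\<in>Xs i. \<forall>z\<in>other_inputs n Xs i. pmf P (z(i := a)) = pmf q a * pmf (K a) z}"

definition Q_channels ::
    "nat \<Rightarrow> (nat \<Rightarrow> 'a set) \<Rightarrow> 'y set \<Rightarrow> ((nat \<Rightarrow> 'a) \<Rightarrow> 'y pmf) \<Rightarrow> nat \<Rightarrow> ('a \<Rightarrow> 'y pmf) set" where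
  "Q_channels n Xs Y p i =
     {W \<in> channels (Xs i) Y. \<exists>K\<in>conditionals n Xs i. \<forall>a\<in>Xs i. \<forall>y\<in>Y.
        pmf (W a) y = (\<Sum>z\<in>other_inputs n Xs i. pmf (p (z(i := a))) y * pmf (K a) z)}"

definition S_channels ::
    "nat \<Rightarrow> (nat \<Rightarrow> 'a set) \<Rightarrow> 'y set \<Rightarrow> ((nat \<Rightarrow> 'a) \<Rightarrow> 'y pmf) \<Rightarrow> nat \<Rightarrow> ('a \<Rightarrow> 'y pmf) set" where
  "S_channels n Xs Y p i =
     {W \<in> channels (Xs i) Y. \<forall>a\<in>Xs i. \<exists>z\<in>other_inputs n Xs i. \<forall>y\<in>Y.
        pmf (W a) y = pmf (p (z(i := a))) y}"

end

theory Submission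
  imports Defs
begin

text \<open>
  A row of a channel in $\mathbb{Q}_i$ is a mixture of rows $p(\cdot|x_i,x_{(i)})$ with weights
  $p(x_{(i)}|x_i)$.  Mixing the rows independently, a selector $s$ of one $x_{(i)}$ for every $x_i$
  gets the weight $\prod_{x_i} p(s(x_i)|x_i)$, and these weights exhibit the channel as a convex
  combination of channels in $\mathbb{S}_i$.  For a fixed input distribution, mutual information is
  convex in the channel (log-sum inequality), so the capacity of a channel in $\mathbb{Q}_i$ is
  at most the largest capacity on the finite set $\mathbb{S}_i$.  This also yields the existence of
  the maxima over $\mathbb{Q}_i$ and over $X$ without any compactness in the channel; compactness
  is needed only for the input distribution of a single channel.  Finally, the pairs
  $(X_i, Y)$ arising from some $X$ are exactly those given by an input distribution and a channel
  in $\mathbb{Q}_i$.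
\<close>

section \<open>Mutual information of a finite channel as an explicit sum\<close>

text \<open>The logarithm is taken of the density p(y|a) / p(y), with the input probability already
  cancelled. A summand whose joint probability vanishes is 0 whatever value the logarithm and the
  quotient take there, so no support condition is written.\<close>

definition info_sum :: "real \<Rightarrow> 'x set \<Rightarrow> 'y set \<Rightarrow> 'x pmf \<Rightarrow> ('x \<Rightarrow> 'y pmf) \<Rightarrow> real" where
  "info_sum b A B q W = (\<Sum>a\<in>A. \<Sum>y\<in>B.
     pmf q a * pmf (W a) y * log b (pmf (W a) y / (\<Sum>a'\<in>A. pmf q a' * pmf (W a') y)))"

lemma sum_pmf_dists: "finite A \<Longrightarrow> q \<in> dists A \<Longrightarrow> (\<Sum>a\<in>A. pmf q a) = 1"
  by (simp add: dists_def sum_pmf_eq_1)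

lemma sum_pmf_channel: "finite B \<Longrightarrow> W \<in> channels A B \<Longrightarrow> a \<in> A \<Longrightarrow> (\<Sum>y\<in>B. pmf (W a) y) = 1"
  by (rule sum_pmf_dists) (auto simp: channels_def)

lemma dists_not_empty: "q \<in> dists A \<Longrightarrow> A \<noteq> {}"
  using set_pmf_not_empty[of q] by (auto simp: dists_def)

text \<open>Stated for two arbitrary variables on a finite space so that it covers both informations
  of the claim: the two projections of A \<times> B, and one coordinate of a random vector together
  with the output. By \<open>im\<close> the sums over attained values, which the formula for simple
  distributions produces, run over all of A \<times> B, null points included.\<close>

lemma mutual_information_point_measure:
  fixes f :: "'o \<Rightarrow> real"
  assumes fin: "finite \<Omega>" and f0: "\<And>\<omega>. \<omega> \<in> \<Omega> \<Longrightarrow> 0 \<le> f \<omega>"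
    and im: "(\<lambda>\<omega>. (X \<omega>, Z \<omega>)) ` \<Omega> = A \<times> B"
    and q: "q \<in> dists A" and W: "W \<in> channels A B" and b: "b > 1"
    and law: "\<And>a y. a \<in> A \<Longrightarrow> y \<in> B \<Longrightarrow>
       (\<Sum>\<omega>\<in>{\<omega>\<in>\<Omega>. X \<omega> = a \<and> Z \<omega> = y}. f \<omega>) = pmf q a * pmf (W a) y"
  shows "prob_space.mutual_information (point_measure \<Omega> (\<lambda>\<omega>. ennreal (f \<omega>))) b
           (count_space A) (count_space B) X Z = info_sum b A B q W"
proof -
  let ?M = "point_measure \<Omega> (\<lambda>\<omega>. ennreal (f \<omega>))"
  have A0: "A \<noteq> {}" using q by (rule dists_not_empty)
  have B0: "B \<noteq> {}" using A0 W dists_not_empty by (fastforce simp: channels_def)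
  have XA: "X ` \<Omega> = A"
    using arg_cong[OF im, of "image fst"] B0 by (simp add: image_image)
  have ZB: "Z ` \<Omega> = B"
    using arg_cong[OF im, of "image snd"] A0 by (simp add: image_image)
  have finA: "finite A" and finB: "finite B" using fin XA ZB by auto
  \<comment> \<open>Every event used below depends on the pair of variables only. The total mass,
    both marginals and the joint law are the cases \<open>T = A \<times> B\<close>,
    \<open>{a} \<times> B\<close>, \<open>A \<times> {y}\<close> and \<open>{t}\<close>.\<close>
  have sum_law: "(\<Sum>\<omega>\<in>S. f \<omega>) = (\<Sum>(a, y)\<in>T. pmf q a * pmf (W a) y)"
    if T: "T \<subseteq> A \<times> B" and S: "S = {\<omega>\<in>\<Omega>. (X \<omega>, Z \<omega>) \<in> T}" for S T
  proof -
    have "finite T" using finite_subset[OF T] finA finB by auto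
    moreover have "finite S" using S fin by auto
    ultimately have "(\<Sum>\<omega>\<in>S. f \<omega>) = (\<Sum>t\<in>T. \<Sum>\<omega>\<in>{\<omega>. \<omega> \<in> S \<and> (X \<omega>, Z \<omega>) = t}. f \<omega>)"
      by (intro sum.group[symmetric]) (auto simp: S)
    also have "\<dots> = (\<Sum>t\<in>T. pmf q (fst t) * pmf (W (fst t)) (snd t))"
    proof (intro sum.cong refl)
      fix t assume t: "t \<in> T"
      obtain a y where ay: "t = (a, y)" by force
      have "{\<omega>. \<omega> \<in> S \<and> (X \<omega>, Z \<omega>) = t} = {\<omega>\<in>\<Omega>. X \<omega> = a \<and> Z \<omega> = y}"
        using t by (auto simp: S ay)
      then show "(\<Sum>\<omega>\<in>{\<omega>. \<omega> \<in> S \<and> (X \<omega>, Z \<omega>) = t}. f \<omega>) = pmf q (fst t) * pmf (W (fst t)) (snd t)"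
        using t T law[of a y] by (auto simp: ay)
    qed
    finally show ?thesis by (simp add: case_prod_unfold)
  qed
  have total: "(\<Sum>\<omega>\<in>\<Omega>. f \<omega>) = 1"
  proof -
    have "(\<Sum>\<omega>\<in>\<Omega>. f \<omega>) = (\<Sum>(a, y)\<in>A \<times> B. pmf q a * pmf (W a) y)"
      by (rule sum_law) (use XA ZB in auto)
    also have "\<dots> = (\<Sum>a\<in>A. pmf q a * (\<Sum>y\<in>B. pmf (W a) y))"
      by (simp add: sum.cartesian_product sum_distrib_left)
    also have "\<dots> = 1"
      using sum_pmf_channel[OF finB W] sum_pmf_dists[OF finA q] by simp
    finally show ?thesis .
  qed
  have ps: "prob_space ?M"
    using fin f0 total by (intro prob_space_point_measure) (auto simp: sum_ennreal)
  interpret information_space ?M b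
    using ps b by (simp add: information_space_def information_space_axioms_def)
  have meas: "measure ?M S = (\<Sum>\<omega>\<in>S. f \<omega>)" if "S \<subseteq> \<Omega>" for S
  proof -
    have "emeasure ?M S = ennreal (\<Sum>\<omega>\<in>S. f \<omega>)"
      using that fin f0 by (subst emeasure_point_measure_finite) (auto intro!: sum_ennreal)
    then show ?thesis
      using that f0 by (auto simp: measure_def subset_iff intro!: sum_nonneg enn2real_ennreal)
  qed
  define r where "r y = (\<Sum>a'\<in>A. pmf q a' * pmf (W a') y)" for y
  have r0: "0 \<le> r y" for y by (auto simp: r_def intro!: sum_nonneg)
  have dX: "simple_distributed ?M X (pmf q)"
  proof (rule simple_distributedI)
    fix a assume "a \<in> X ` space ?M"
    then have a: "a \<in> A" by (simp add: space_point_measure XA)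
    have "measure ?M (X -` {a} \<inter> space ?M) = (\<Sum>\<omega>\<in>{\<omega>\<in>\<Omega>. X \<omega> = a}. f \<omega>)"
      by (subst meas) (auto simp: space_point_measure intro!: sum.cong)
    also have "\<dots> = (\<Sum>(a, y)\<in>{a} \<times> B. pmf q a * pmf (W a) y)"
      by (rule sum_law) (use ZB a in auto)
    also have "\<dots> = (\<Sum>y\<in>B. pmf q a * pmf (W a) y)"
      by (subst sum.cartesian_product[symmetric]) simp
    also have "\<dots> = pmf q a"
      using sum_pmf_channel[OF finB W a] by (simp add: sum_distrib_left[symmetric])
    finally show "pmf q a = measure ?M (X -` {a} \<inter> space ?M)" by simp
  qed (auto simp: fin)
  have dZ: "simple_distributed ?M Z r"
  proof (rule simple_distributedI)
    fix y assume "y \<in> Z ` space ?M"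
    then have y: "y \<in> B" by (simp add: space_point_measure ZB)
    have "measure ?M (Z -` {y} \<inter> space ?M) = (\<Sum>\<omega>\<in>{\<omega>\<in>\<Omega>. Z \<omega> = y}. f \<omega>)"
      by (subst meas) (auto simp: space_point_measure intro!: sum.cong)
    also have "\<dots> = (\<Sum>(a, y)\<in>A \<times> {y}. pmf q a * pmf (W a) y)"
      by (rule sum_law) (use XA y in auto)
    also have "\<dots> = r y"
      by (subst sum.cartesian_product[symmetric]) (simp add: r_def)
    finally show "r y = measure ?M (Z -` {y} \<inter> space ?M)" by simp
  qed (auto simp: fin r0)
  have dXZ: "simple_distributed ?M (\<lambda>\<omega>. (X \<omega>, Z \<omega>)) (\<lambda>t. pmf q (fst t) * pmf (W (fst t)) (snd t))"
  proof (rule simple_distributedI)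
    fix t assume "t \<in> (\<lambda>\<omega>. (X \<omega>, Z \<omega>)) ` space ?M"
    then have t: "t \<in> A \<times> B" by (simp add: space_point_measure im)
    have "measure ?M ((\<lambda>\<omega>. (X \<omega>, Z \<omega>)) -` {t} \<inter> space ?M)
        = (\<Sum>\<omega>\<in>{\<omega>\<in>\<Omega>. (X \<omega>, Z \<omega>) = t}. f \<omega>)"
      by (subst meas) (auto simp: space_point_measure intro!: sum.cong)
    also have "\<dots> = (\<Sum>(a, y)\<in>{t}. pmf q a * pmf (W a) y)"
      by (rule sum_law) (use t in auto)
    finally show "pmf q (fst t) * pmf (W (fst t)) (snd t)
        = measure ?M ((\<lambda>\<omega>. (X \<omega>, Z \<omega>)) -` {t} \<inter> space ?M)"
      by (simp add: case_prod_unfold)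
  qed (auto simp: fin)
  have "mutual_information b (count_space A) (count_space B) X Z
     = (\<Sum>(a, y)\<in>A \<times> B. pmf q a * pmf (W a) y * log b (pmf q a * pmf (W a) y / (pmf q a * r y)))"
    using mutual_information_simple_distributed[OF dX dZ dXZ]
    by (simp add: space_point_measure XA ZB im)
  \<comment> \<open>The factor \<open>pmf q a\<close> cancels inside the logarithm; where it is 0,
    both summands are 0.\<close>
  also have "\<dots> = (\<Sum>(a, y)\<in>A \<times> B. pmf q a * pmf (W a) y * log b (pmf (W a) y / r y))"
    by (intro sum.cong refl) (auto simp: case_prod_unfold)
  finally show ?thesis
    by (simp add: info_sum_def r_def sum.cartesian_product)
qed

lemma channel_info_eq_info_sum:
  assumes "finite A" "finite B" "q \<in> dists A" "W \<in> channels A B" "b > 1"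
  shows "channel_info b A B q W = info_sum b A B q W"
proof -
  have "prob_space.mutual_information
          (point_measure (A \<times> B) (\<lambda>\<omega>. ennreal (pmf q (fst \<omega>) * pmf (W (fst \<omega>)) (snd \<omega>)))) b
           (count_space A) (count_space B) fst snd = info_sum b A B q W"
  proof (rule mutual_information_point_measure)
    fix a y assume "a \<in> A" "y \<in> B"
    then have "{\<omega> \<in> A \<times> B. fst \<omega> = a \<and> snd \<omega> = y} = {(a, y)}" by auto
    then show "(\<Sum>\<omega>\<in>{\<omega> \<in> A \<times> B. fst \<omega> = a \<and> snd \<omega> = y}. pmf q (fst \<omega>) * pmf (W (fst \<omega>)) (snd \<omega>))
        = pmf q a * pmf (W a) y" by simp
  qed (use assms in auto)
  then show ?thesis
    by (simp add: channel_info_def joint_space_def case_prod_unfold)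
qed

section \<open>An optimal input distribution for a single channel\<close>

text \<open>Only the point 0 needs work: substituting 1/x turns the right-hand limit there into the
  limit of - ln x / x at infinity, which is 0.\<close>

lemma continuous_on_x_ln_x: "continuous_on {0..} (\<lambda>x::real. x * ln x)"
proof (intro continuous_on_eq_continuous_within[THEN iffD2] ballI)
  fix x :: real assume x: "x \<in> {0..}"
  show "continuous (at x within {0..}) (\<lambda>x. x * ln x)"
  proof (cases "x = 0")
    case True
    have "((\<lambda>x::real. - (ln x / x)) \<longlongrightarrow> - 0) at_top"
      by (intro tendsto_minus ln_x_over_x_tendsto_0)
    moreover have "\<forall>\<^sub>F x::real in at_top. - (ln x / x) = inverse x * ln (inverse x)"
      using eventually_gt_at_top[of 0] by eventually_elim (simp add: ln_inverse divide_inverse)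
    ultimately have "((\<lambda>x::real. x * ln x) \<longlongrightarrow> 0) (at_right 0)"
      unfolding filterlim_at_right_to_top by (simp add: filterlim_cong)
    then show ?thesis
      using True by (simp add: continuous_within at_within_Ici_at_right)
  next
    case False
    then show ?thesis using x by (intro continuous_intros) auto
  qed
qed

text \<open>Coordinates outside \<open>A\<close> are pinned to 0, so the simplex is a closed subset
  of a product of compact sets indexed by the whole type, and Tychonoff applies. The sum condition
  is closed because it involves finitely many coordinates.\<close>

lemma compact_simplex:
  "compact {v :: 'a \<Rightarrow> real. (\<forall>a\<in>A. 0 \<le> v a) \<and> (\<forall>a. a \<notin> A \<longrightarrow> v a = 0) \<and> sum v A = 1}"
    (is "compact ?S") if fin: "finite A" for A :: "'a set"
proof -
  let ?P = "PiE UNIV (\<lambda>a. if a \<in> A then {0..1::real} else {0})"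
  have "compactin (product_topology (\<lambda>_. euclidean) UNIV) ?P"
    by (subst compactin_PiE) auto
  then have "compact ?P" by (simp add: euclidean_product_topology)
  moreover have "closed {v :: 'a \<Rightarrow> real. sum v A = 1}"
    by (intro closed_Collect_eq continuous_intros continuous_on_product_coordinates)
  ultimately have "compact (?P \<inter> {v. sum v A = 1})" by (rule compact_Int_closed)
  also have "?P \<inter> {v. sum v A = 1} = ?S"
  proof (intro equalityI subsetI)
    fix v assume v: "v \<in> ?S"
    then have "v a \<le> 1" if "a \<in> A" for a
      using member_le_sum[of a A v] fin that by auto
    with v show "v \<in> ?P \<inter> {v. sum v A = 1}" by (auto simp: PiE_iff)
  qed (auto simp: PiE_iff split: if_splits)
  finally show ?thesis .
qed

text \<open>
  In this form continuity in \<open>q\<close> is visible also where an output probability vanishes, since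
  $x \ln x$ is continuous at $0$ with Isabelle's value $0 \cdot \ln 0 = 0$.
\<close>

lemma info_sum_eq_entropy_difference:
  assumes fin: "finite A" and b: "b > 1"
  shows "info_sum b A B q W =
    ((\<Sum>a\<in>A. \<Sum>y\<in>B. pmf q a * (pmf (W a) y * ln (pmf (W a) y)))
      - (\<Sum>y\<in>B. (\<Sum>a\<in>A. pmf q a * pmf (W a) y) * ln (\<Sum>a\<in>A. pmf q a * pmf (W a) y))) / ln b"
proof -
  define r where "r y = (\<Sum>a\<in>A. pmf q a * pmf (W a) y)" for y
  have r0: "0 \<le> r y" for y by (auto simp: r_def intro!: sum_nonneg)
  have summand: "pmf q a * pmf (W a) y * log b (pmf (W a) y / r y)
      = (pmf q a * (pmf (W a) y * ln (pmf (W a) y)) - pmf q a * pmf (W a) y * ln (r y)) / ln b"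
    if a: "a \<in> A" for a y
  proof (cases "pmf q a * pmf (W a) y = 0")
    case False
    have "pmf q a * pmf (W a) y \<le> r y"
      unfolding r_def using member_le_sum[of a A "\<lambda>a. pmf q a * pmf (W a) y"] a fin by simp
    moreover have "pmf q a * pmf (W a) y > 0"
      using False by (simp add: order_less_le)
    ultimately have "r y > 0" by linarith
    moreover have "pmf (W a) y > 0" using False by (simp add: order_less_le)
    ultimately show ?thesis by (simp add: log_def ln_div field_simps)
  qed auto
  have "info_sum b A B q W = (\<Sum>a\<in>A. \<Sum>y\<in>B.
      (pmf q a * (pmf (W a) y * ln (pmf (W a) y)) - pmf q a * pmf (W a) y * ln (r y)) / ln b)"
    unfolding info_sum_def r_def[symmetric] by (intro sum.cong refl summand)
  also have "\<dots> = ((\<Sum>a\<in>A. \<Sum>y\<in>B. pmf q a * (pmf (W a) y * ln (pmf (W a) y)))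
      - (\<Sum>a\<in>A. \<Sum>y\<in>B. pmf q a * pmf (W a) y * ln (r y))) / ln b"
    by (simp add: sum_divide_distrib[symmetric] sum_subtractf)
  also have "(\<Sum>a\<in>A. \<Sum>y\<in>B. pmf q a * pmf (W a) y * ln (r y)) = (\<Sum>y\<in>B. r y * ln (r y))"
    by (subst sum.swap) (simp add: r_def sum_distrib_right)
  finally show ?thesis by (simp add: r_def)
qed

text \<open>Distributions on \<open>A\<close> correspond to points of the simplex, on which the
  entropy form of the information is continuous. A maximiser exists by compactness and becomes a
  distribution again through \<open>embed_pmf\<close>.\<close>

lemma info_sum_attains_sup:
  fixes A :: "'a set"
  assumes fin: "finite A" and A0: "A \<noteq> {}" and b: "b > 1"
  shows "\<exists>q\<in>dists A. \<forall>q'\<in>dists A. info_sum b A B q' W \<le> info_sum b A B q W"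
proof -
  define S where "S = {v :: 'a \<Rightarrow> real. (\<forall>a\<in>A. 0 \<le> v a) \<and> (\<forall>a. a \<notin> A \<longrightarrow> v a = 0) \<and> sum v A = 1}"
  define F where "F v = ((\<Sum>a\<in>A. \<Sum>y\<in>B. v a * (pmf (W a) y * ln (pmf (W a) y)))
      - (\<Sum>y\<in>B. (\<Sum>a\<in>A. v a * pmf (W a) y) * ln (\<Sum>a\<in>A. v a * pmf (W a) y))) / ln b"
    for v :: "'a \<Rightarrow> real"
  have coord: "continuous_on S (\<lambda>v. v a)" for a
    by (rule continuous_on_subset[OF continuous_on_product_coordinates]) simp
  \<comment> \<open>The output probability is nonnegative on the simplex, so it stays in the domain
    on which x ln x is continuous.\<close>
  have cont: "continuous_on S (\<lambda>v. (\<Sum>a\<in>A. v a * pmf (W a) y) * ln (\<Sum>a\<in>A. v a * pmf (W a) y))" for y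
    by (rule continuous_on_compose2[OF continuous_on_x_ln_x])
       (auto intro!: continuous_intros coord sum_nonneg simp: S_def[symmetric], auto simp: S_def)
  have "continuous_on S F"
    unfolding F_def using b
    by (intro continuous_on_divide continuous_on_diff continuous_on_sum cont
        continuous_on_mult coord continuous_on_const) auto
  moreover have "compact S" unfolding S_def by (rule compact_simplex[OF fin])
  moreover have pmf_S: "pmf q \<in> S" if "q \<in> dists A" for q
    using that fin by (auto simp: S_def sum_pmf_dists dists_def set_pmf_eq)
  \<comment> \<open>A point mass shows that the simplex is nonempty.\<close>
  moreover obtain a where "a \<in> A" using A0 by blast
  then have "return_pmf a \<in> dists A" by (simp add: dists_def)
  ultimately obtain v where v: "v \<in> S" "\<And>w. w \<in> S \<Longrightarrow> F w \<le> F v"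
    using continuous_attains_sup[of S F] by blast
  have v0: "0 \<le> v a" for a using v(1) by (cases "a \<in> A") (auto simp: S_def)
  have "(\<integral>\<^sup>+ a. ennreal (v a) \<partial>count_space UNIV) = (\<Sum>a\<in>A. ennreal (v a))"
    using v(1) fin by (intro nn_integral_count_space') (auto simp: S_def)
  also have "\<dots> = 1" using v(1) v0 by (simp add: sum_ennreal S_def)
  finally have "pmf (embed_pmf v) = v"
    using v0 by (intro ext pmf_embed_pmf)
  moreover from this have "embed_pmf v \<in> dists A"
    using v(1) by (auto simp: dists_def set_pmf_eq S_def)
  moreover have "info_sum b A B q W = F (pmf q)" for q
    by (simp add: info_sum_eq_entropy_difference[OF fin b] F_def)
  ultimately show ?thesis using v(2) pmf_S by (metis (no_types, lifting))
qed


section \<open>The log-sum inequality and convexity in the channel\<close>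

text \<open>This is the tangent bound ln s - ln t \<le> (s - t) / t at s = U/V and t = u/v,
  multiplied by u. The left side is chosen so that it sums to 0 once U and V are the totals of the u
  and the v.\<close>

lemma log_sum_summand:
  fixes u v U V :: real
  assumes u: "0 \<le> u" and v: "0 \<le> v" and ac: "v = 0 \<Longrightarrow> u = 0" and U: "0 < U" and V: "0 < V"
  shows "u - v * U / V \<le> u * ln (u / v) - u * ln (U / V)"
proof (cases "u = 0")
  case True
  then show ?thesis using v U V by simp
next
  case False
  then have "0 < u" "0 < v" using u v ac by (auto simp: order_less_le)
  then have "u * (ln (U / V) - ln (u / v)) \<le> u * ((U / V - u / v) / (u / v))"
    using U V by (intro mult_left_mono ln_diff_le divide_pos_pos) auto
  also have "\<dots> = v * U / V - u"
    using \<open>0 < u\<close> \<open>0 < v\<close> by (simp add: left_diff_distrib)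
  finally show ?thesis by (simp add: right_diff_distrib)
qed

text \<open>Sum the preceding bound with U and V the two totals: the left sides add up to U - V * U
  / V = 0. If the u have total 0, every term vanishes.\<close>

lemma log_sum_inequality:
  fixes u v :: "'i \<Rightarrow> real"
  assumes fin: "finite T" and u: "\<And>k. k \<in> T \<Longrightarrow> 0 \<le> u k" and v: "\<And>k. k \<in> T \<Longrightarrow> 0 \<le> v k"
    and ac: "\<And>k. k \<in> T \<Longrightarrow> v k = 0 \<Longrightarrow> u k = 0"
  shows "sum u T * ln (sum u T / sum v T) \<le> (\<Sum>k\<in>T. u k * ln (u k / v k))"
proof (cases "sum u T = 0")
  case True
  then have "\<And>k. k \<in> T \<Longrightarrow> u k = 0" using sum_nonneg_eq_0_iff[of T u] fin u by auto
  then show ?thesis by simp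
next
  case False
  then have U: "0 < sum u T" using u by (simp add: order_less_le sum_nonneg)
  have "sum v T \<noteq> 0"
  proof
    assume "sum v T = 0"
    then have "\<And>k. k \<in> T \<Longrightarrow> v k = 0" using sum_nonneg_eq_0_iff[of T v] fin v by auto
    then have "sum u T = 0" using ac by simp
    with False show False by contradiction
  qed
  then have V: "0 < sum v T" using v by (simp add: order_less_le sum_nonneg)
  have "(\<Sum>k\<in>T. u k - v k * sum u T / sum v T)
      \<le> (\<Sum>k\<in>T. u k * ln (u k / v k) - u k * ln (sum u T / sum v T))"
    by (intro sum_mono log_sum_summand u v ac U V)
  moreover have "(\<Sum>k\<in>T. u k - v k * sum u T / sum v T) = 0"
    using V by (simp add: sum_subtractf flip: sum_distrib_right sum_divide_distrib)
  ultimately show ?thesis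
    by (simp add: sum_subtractf flip: sum_distrib_right)
qed

text \<open>With \<open>q\<close> fixed, the output probability is linear in the channel. For each
  pair (a, y) the log-sum inequality is applied over \<open>T\<close> to the numbers
  \<open>c V * pmf (V a) y\<close> and \<open>c V * r V y\<close>, whose totals are
  \<open>pmf (W a) y\<close> and \<open>r W y\<close>.\<close>

lemma info_sum_convex:
  fixes A :: "'a set" and B :: "'b set" and W :: "'a \<Rightarrow> 'b pmf"
  assumes fin: "finite A" "finite T" and b: "b > 1"
    and c: "\<And>V. V \<in> T \<Longrightarrow> 0 \<le> c V"
    and W: "\<And>a y. a \<in> A \<Longrightarrow> y \<in> B \<Longrightarrow> pmf (W a) y = (\<Sum>V\<in>T. c V * pmf (V a) y)"
  shows "info_sum b A B q W \<le> (\<Sum>V\<in>T. c V * info_sum b A B q V)"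
proof -
  define r where "r V y = (\<Sum>a\<in>A. pmf q a * pmf (V a) y)" for V :: "'a \<Rightarrow> 'b pmf" and y
  have r0: "0 \<le> r V y" for V y by (auto simp: r_def intro!: sum_nonneg)
  have rW: "r W y = (\<Sum>V\<in>T. c V * r V y)" if "y \<in> B" for y
  proof -
    have "r W y = (\<Sum>a\<in>A. \<Sum>V\<in>T. c V * (pmf q a * pmf (V a) y))"
      using W that by (simp add: r_def sum_distrib_left mult_ac)
    also have "\<dots> = (\<Sum>V\<in>T. c V * r V y)"
      by (subst sum.swap) (simp add: r_def sum_distrib_left)
    finally show ?thesis .
  qed
  have summand: "pmf q a * pmf (W a) y * log b (pmf (W a) y / r W y)
      \<le> (\<Sum>V\<in>T. c V * (pmf q a * pmf (V a) y * log b (pmf (V a) y / r V y)))"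
    if a: "a \<in> A" and y: "y \<in> B" for a y
  proof (cases "pmf q a = 0")
    case False
    have "pmf (W a) y * ln (pmf (W a) y / r W y)
        \<le> (\<Sum>V\<in>T. c V * pmf (V a) y * ln ((c V * pmf (V a) y) / (c V * r V y)))"
      unfolding W[OF a y] rW[OF y]
    proof (rule log_sum_inequality)
      fix V assume V: "V \<in> T" "c V * r V y = 0"
      show "c V * pmf (V a) y = 0"
      proof (cases "c V = 0")
        case False
        \<comment> \<open>An output of probability 0 cannot be reached from any input of positive
          probability; this is where the case \<open>pmf q a \<noteq> 0\<close> enters.\<close>
        with V have "r V y = 0" by simp
        then have "pmf q a * pmf (V a) y = 0"
          using sum_nonneg_eq_0_iff[of A "\<lambda>a. pmf q a * pmf (V a) y"] a fin by (simp add: r_def)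
        with \<open>pmf q a \<noteq> 0\<close> show ?thesis by simp
      qed simp
    qed (use fin c r0 in auto)
    \<comment> \<open>The weight \<open>c V\<close> cancels in the quotient, or is 0 and kills both
      terms.\<close>
    also have "\<dots> = (\<Sum>V\<in>T. c V * (pmf (V a) y * ln (pmf (V a) y / r V y)))"
      by (intro sum.cong refl) auto
    finally have "pmf q a / ln b * (pmf (W a) y * ln (pmf (W a) y / r W y))
        \<le> pmf q a / ln b * (\<Sum>V\<in>T. c V * (pmf (V a) y * ln (pmf (V a) y / r V y)))"
      using b by (intro mult_left_mono) auto
    then show ?thesis by (simp add: log_def sum_distrib_left mult_ac)
  qed simp
  have "info_sum b A B q W \<le> (\<Sum>a\<in>A. \<Sum>y\<in>B. \<Sum>V\<in>T. c V * (pmf q a * pmf (V a) y * log b (pmf (V a) y / r V y)))"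
    unfolding info_sum_def r_def[symmetric] by (intro sum_mono summand)
  also have "\<dots> = (\<Sum>a\<in>A. \<Sum>V\<in>T. \<Sum>y\<in>B. c V * (pmf q a * pmf (V a) y * log b (pmf (V a) y / r V y)))"
    by (intro sum.cong refl sum.swap)
  also have "\<dots> = (\<Sum>V\<in>T. \<Sum>a\<in>A. \<Sum>y\<in>B. c V * (pmf q a * pmf (V a) y * log b (pmf (V a) y / r V y)))"
    by (rule sum.swap)
  finally show ?thesis
    by (simp add: info_sum_def r_def sum_distrib_left)
qed


section \<open>Attained maxima, and distributions on finite sets\<close>

lemma maximum_eqI: "x \<in> A \<Longrightarrow> (\<And>y. y \<in> A \<Longrightarrow> f y \<le> f x) \<Longrightarrow> maximum A f = f x"
  unfolding maximum_def by (rule Greatest_equality) auto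

lemma has_maximumE:
  assumes "has_maximum A f"
  obtains x where "x \<in> A" "maximum A f = f x" "\<And>y. y \<in> A \<Longrightarrow> f y \<le> maximum A f"
  using assms maximum_eqI[of _ A f] unfolding has_maximum_def by metis

lemma has_maximum_finite: "finite A \<Longrightarrow> A \<noteq> {} \<Longrightarrow> has_maximum A f"
  unfolding has_maximum_def
  using Max_in[of "f ` A"] Max_ge[of "f ` A"] by (metis (no_types, lifting) finite_imageI image_iff image_is_empty)

lemma has_maximum_cong: "(\<And>x. x \<in> A \<Longrightarrow> f x = g x) \<Longrightarrow> has_maximum A f \<longleftrightarrow> has_maximum A g"
  unfolding has_maximum_def by auto

lemma has_maximum_channel_info:
  assumes "finite A" "A \<noteq> {}" "finite B" "W \<in> channels A B" "b > 1"
  shows "has_maximum (dists A) (\<lambda>q. channel_info b A B q W)"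
proof -
  have "has_maximum (dists A) (\<lambda>q. info_sum b A B q W)"
    using info_sum_attains_sup assms by (auto simp: has_maximum_def)
  then show ?thesis
    using assms by (subst has_maximum_cong) (auto simp: channel_info_eq_info_sum)
qed

text \<open>The Shannon capacity of a single channel, that is, the innermost maximum of the
  claim.\<close>

definition channel_capacity :: "real \<Rightarrow> 'x set \<Rightarrow> 'y set \<Rightarrow> ('x \<Rightarrow> 'y pmf) \<Rightarrow> real" where
  "channel_capacity b A B W = maximum (dists A) (\<lambda>q. channel_info b A B q W)"

lemma pmf_eqI_dists:
  assumes "q \<in> dists B" "q' \<in> dists B" "\<And>y. y \<in> B \<Longrightarrow> pmf q y = pmf q' y"
  shows "q = q'"
proof (rule pmf_eqI)
  fix y show "pmf q y = pmf q' y"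
  proof (cases "y \<in> B")
    case False
    then have "y \<notin> set_pmf q" "y \<notin> set_pmf q'" using assms(1,2) by (auto simp: dists_def)
    then show ?thesis by (simp add: set_pmf_iff)
  qed (rule assms(3))
qed

lemma channels_eqI:
  assumes W: "W \<in> channels A B" "W' \<in> channels A B"
    and "\<And>a y. a \<in> A \<Longrightarrow> y \<in> B \<Longrightarrow> pmf (W a) y = pmf (W' a) y"
  shows "W = W'"
proof (rule PiE_ext[OF W[unfolded channels_def]])
  fix a assume "a \<in> A"
  then show "W a = W' a" using assms by (intro pmf_eqI_dists[of _ B]) (auto simp: channels_def)
qed

lemma pmf_bind_finite:
  assumes "finite A" "set_pmf q \<subseteq> A"
  shows "pmf (bind_pmf q f) y = (\<Sum>a\<in>A. pmf q a * pmf (f a) y)"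
  using assms unfolding pmf_bind
  by (subst integral_measure_pmf_real[where A = A]) (auto simp: mult.commute)

section \<open>A fixed coordinate i: splitting an input into x_i and the rest\<close>

locale channel_coordinate =
  fixes n :: nat and Xs :: "nat \<Rightarrow> 'a set" and Y :: "'y set"
    and p :: "(nat \<Rightarrow> 'a) \<Rightarrow> 'y pmf" and i :: nat
  assumes i: "i \<in> {1..n}"
    and finite_Xs: "\<And>j. j \<in> {1..n} \<Longrightarrow> finite (Xs j)"
    and Xs_nonempty: "\<And>j. j \<in> {1..n} \<Longrightarrow> Xs j \<noteq> {}"
    and finite_Y: "finite Y"
    and p: "p \<in> channels (inputs n Xs) Y"
begin

abbreviation A where "A \<equiv> Xs i"
abbreviation Z where "Z \<equiv> other_inputs n Xs i"
abbreviation Q where "Q \<equiv> Q_channels n Xs Y p i"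
abbreviation S where "S \<equiv> S_channels n Xs Y p i"

lemma finite_A: "finite A" and A_nonempty: "A \<noteq> {}"
  using i finite_Xs Xs_nonempty by auto

lemma finite_Z: "finite Z" and Z_nonempty: "Z \<noteq> {}" and finite_inputs: "finite (inputs n Xs)"
  using finite_Xs Xs_nonempty
  by (auto simp: other_inputs_def inputs_def PiE_eq_empty_iff intro!: finite_PiE)

lemma upd_in_inputs: "a \<in> A \<Longrightarrow> z \<in> Z \<Longrightarrow> z(i := a) \<in> inputs n Xs"
  using i by (auto simp: inputs_def other_inputs_def PiE_iff extensional_def)

text \<open>Elements of \<open>Z\<close> are \<open>undefined\<close> at \<open>i\<close>, so
  overwriting that coordinate loses nothing. Together with \<open>inputs_split\<close> this
  identifies the inputs with pairs (x_i, x_(i)).\<close>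

lemma upd_eq_iff:
  assumes z: "z \<in> Z" "z' \<in> Z"
  shows "z(i := a) = z'(i := a') \<longleftrightarrow> a = a' \<and> z = z'"
proof
  assume eq: "z(i := a) = z'(i := a')"
  have "z j = z' j" for j
    using fun_cong[OF eq, of j] z by (cases "j = i") (auto simp: other_inputs_def PiE_iff extensional_def)
  then show "a = a' \<and> z = z'" using fun_cong[OF eq, of i] by auto
qed simp

lemma inputs_split:
  assumes "x \<in> inputs n Xs"
  shows "x i \<in> A" "restrict x ({1..n} - {i}) \<in> Z" "(restrict x ({1..n} - {i}))(i := x i) = x"
  using assms i by (auto simp: inputs_def other_inputs_def PiE_iff extensional_def fun_eq_iff)

lemma p_dists: "a \<in> A \<Longrightarrow> z \<in> Z \<Longrightarrow> p (z(i := a)) \<in> dists Y"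
  using p upd_in_inputs by (auto simp: channels_def)

text \<open>The event X_i = a, Y = y is parametrised by the remaining coordinates through
  \<open>z \<mapsto> (z(i := a), y)\<close>. Hence \<open>law\<close> says that (X_i, Y) has the
  joint law of the input \<open>q\<close> and the output of \<open>W\<close>, and mutual information
  depends on that law only.\<close>

lemma coord_info_eq_info_sum:
  assumes P: "P \<in> dists (inputs n Xs)" and q: "q \<in> dists A" and W: "W \<in> channels A Y" and b: "b > 1"
    and law: "\<And>a y. a \<in> A \<Longrightarrow> y \<in> Y \<Longrightarrow>
      (\<Sum>z\<in>Z. pmf P (z(i := a)) * pmf (p (z(i := a))) y) = pmf q a * pmf (W a) y"
  shows "coord_info b n Xs Y p i P = info_sum b A Y q W"
proof -
  have "prob_space.mutual_information
          (point_measure (inputs n Xs \<times> Y) (\<lambda>\<omega>. ennreal (pmf P (fst \<omega>) * pmf (p (fst \<omega>)) (snd \<omega>)))) b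
           (count_space A) (count_space Y) (\<lambda>\<omega>. fst \<omega> i) snd = info_sum b A Y q W"
  proof (rule mutual_information_point_measure)
    show "(\<lambda>\<omega>. (fst \<omega> i, snd \<omega>)) ` (inputs n Xs \<times> Y) = A \<times> Y"
    proof (intro equalityI subsetI)
      fix t assume t: "t \<in> A \<times> Y"
      \<comment> \<open>Any completion of the letter to a full input will do.\<close>
      obtain z where "z \<in> Z" using Z_nonempty by blast
      then have "(z(i := fst t), snd t) \<in> inputs n Xs \<times> Y" using t upd_in_inputs by auto
      then show "t \<in> (\<lambda>\<omega>. (fst \<omega> i, snd \<omega>)) ` (inputs n Xs \<times> Y)" by (force simp: image_iff)
    qed (auto simp: inputs_split)
    fix a y assume a: "a \<in> A" and y: "y \<in> Y"
    have "bij_betw (\<lambda>z. (z(i := a), y)) Z {\<omega> \<in> inputs n Xs \<times> Y. fst \<omega> i = a \<and> snd \<omega> = y}"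
    proof (rule bij_betwI[where g = "\<lambda>\<omega>. restrict (fst \<omega>) ({1..n} - {i})"])
      show "restrict (fst (z(i := a), y)) ({1..n} - {i}) = z" if "z \<in> Z" for z
        using that by (auto simp: other_inputs_def PiE_iff extensional_def fun_eq_iff)
    qed (use a y upd_in_inputs inputs_split in auto)
    from sum.reindex_bij_betw[OF this, of "\<lambda>\<omega>. pmf P (fst \<omega>) * pmf (p (fst \<omega>)) (snd \<omega>)"]
    show "(\<Sum>\<omega>\<in>{\<omega> \<in> inputs n Xs \<times> Y. fst \<omega> i = a \<and> snd \<omega> = y}. pmf P (fst \<omega>) * pmf (p (fst \<omega>)) (snd \<omega>))
        = pmf q a * pmf (W a) y"
      using law[OF a y] by simp
  qed (use P q W b finite_inputs finite_Y in auto)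
  then show ?thesis
    by (simp add: coord_info_def joint_space_def case_prod_unfold)
qed

section \<open>Gluing and disintegrating input distributions\<close>

text \<open>Draw \<open>a\<close> from \<open>q\<close>, then \<open>z\<close> from
  \<open>K a\<close>, and glue them to \<open>z(i := a)\<close>.\<close>

lemma joint_distribution_exists:
  assumes q: "q \<in> dists A" and K: "K \<in> channels A Z"
  shows "\<exists>P\<in>dists (inputs n Xs). \<forall>a\<in>A. \<forall>z\<in>Z. pmf P (z(i := a)) = pmf q a * pmf (K a) z"
proof (intro bexI ballI)
  let ?P = "bind_pmf q (\<lambda>a. map_pmf (\<lambda>z. z(i := a)) (K a))"
  have qA: "set_pmf q \<subseteq> A" using q by (simp add: dists_def)
  have KZ: "set_pmf (K a) \<subseteq> Z" if "a \<in> A" for a using K that by (auto simp: channels_def dists_def)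
  show "?P \<in> dists (inputs n Xs)"
    using qA KZ upd_in_inputs unfolding dists_def by fastforce
  fix a z assume a: "a \<in> A" and z: "z \<in> Z"
  \<comment> \<open>Gluing is injective in both arguments, so only the draw (a, z) itself produces
    the point \<open>z(i := a)\<close>.\<close>
  have "pmf (map_pmf (\<lambda>z. z(i := a')) (K a')) (z(i := a)) = (if a' = a then pmf (K a) z else 0)"
    if a': "a' \<in> A" for a'
  proof -
    have "pmf (map_pmf (\<lambda>z. z(i := a')) (K a')) (z(i := a))
        = (\<Sum>z'\<in>Z. pmf (K a') z' * indicator {z(i := a)} (z'(i := a')))"
      using finite_Z KZ[OF a'] by (simp add: map_pmf_def pmf_bind_finite pmf_return indicator_def eq_commute)
    also have "\<dots> = (\<Sum>z'\<in>Z. if z' = z then (if a' = a then pmf (K a) z else 0) else 0)"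
      using upd_eq_iff z by (intro sum.cong refl) (auto simp: indicator_def)
    finally show ?thesis using finite_Z z by simp
  qed
  then have "pmf ?P (z(i := a)) = (\<Sum>a'\<in>A. pmf q a' * (if a' = a then pmf (K a) z else 0))"
    unfolding pmf_bind_finite[OF finite_A qA] by (intro sum.cong refl) (simp only:)
  also have "\<dots> = (\<Sum>a'\<in>A. if a' = a then pmf q a * pmf (K a) z else 0)"
    by (intro sum.cong refl) auto
  finally show "pmf ?P (z(i := a)) = pmf q a * pmf (K a) z"
    using finite_A a by simp
qed

text \<open>A point mass as input law, and the joint law glued from it, witness the existential for
  any transition matrix.\<close>

lemma conditionals_eq: "conditionals n Xs i = channels A Z"
proof -
  obtain a where "a \<in> A" using A_nonempty by blast
  then have "return_pmf a \<in> dists A" by (simp add: dists_def)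
  then show ?thesis
    using joint_distribution_exists by (fastforce simp: conditionals_def)
qed

text \<open>Disintegration: \<open>q\<close> is the marginal of coordinate \<open>i\<close>, and
  \<open>K a\<close> is the law of the remaining coordinates conditioned on x_i = a.\<close>

lemma conditional_exists:
  assumes P: "P \<in> dists (inputs n Xs)"
  shows "\<exists>q\<in>dists A. \<exists>K\<in>channels A Z. \<forall>a\<in>A. \<forall>z\<in>Z. pmf P (z(i := a)) = pmf q a * pmf (K a) z"
proof -
  let ?q = "map_pmf (\<lambda>x. x i) P"
  obtain z0 where z0: "z0 \<in> Z" using Z_nonempty by blast
  define E where "E a = {x. x i = a}" for a :: 'a
  \<comment> \<open>Conditioning on a null event is replaced by the point mass at \<open>z0\<close>;
    for such \<open>a\<close> both sides of the product formula are 0.\<close>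
  define K where "K = (\<lambda>a\<in>A. if set_pmf P \<inter> E a = {} then return_pmf z0
    else map_pmf (\<lambda>x. restrict x ({1..n} - {i})) (cond_pmf P (E a)))"
  have PI: "set_pmf P \<subseteq> inputs n Xs" using P by (simp add: dists_def)
  have q: "?q \<in> dists A" using PI inputs_split by (auto simp: dists_def)
  have "K a \<in> dists Z" if "a \<in> A" for a
    using that z0 PI inputs_split(2) by (auto simp: K_def dists_def)
  then have K: "K \<in> channels A Z" by (auto simp: channels_def K_def)
  have qa: "pmf ?q a = measure P (E a)" for a
    by (auto simp: pmf_map E_def intro!: arg_cong[where f = "measure P"])
  have "pmf P (z(i := a)) = pmf ?q a * pmf (K a) z" if a: "a \<in> A" and z: "z \<in> Z" for a z
  proof (cases "set_pmf P \<inter> E a = {}")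
    case True
    then have "z(i := a) \<notin> set_pmf P" by (auto simp: E_def)
    moreover have "measure P (E a) = 0" using True by (auto simp: measure_pmf_zero_iff)
    ultimately show ?thesis by (simp add: qa set_pmf_iff)
  next
    case False
    let ?C = "cond_pmf P (E a)"
    have "pmf (K a) z = measure ?C ((\<lambda>x. restrict x ({1..n} - {i})) -` {z})"
      using False a by (simp add: K_def pmf_map)
    also have "\<dots> = measure ?C ((\<lambda>x. restrict x ({1..n} - {i})) -` {z} \<inter> set_pmf ?C)"
      by (simp add: measure_Int_set_pmf)
    \<comment> \<open>On the support of the conditioned law coordinate \<open>i\<close> equals
      \<open>a\<close>, so the other coordinates determine the point.\<close>
    also have "(\<lambda>x. restrict x ({1..n} - {i})) -` {z} \<inter> set_pmf ?C = {z(i := a)} \<inter> set_pmf ?C"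
    proof (intro equalityI subsetI)
      fix x assume x: "x \<in> (\<lambda>x. restrict x ({1..n} - {i})) -` {z} \<inter> set_pmf ?C"
      then have "x \<in> inputs n Xs" "x i = a" using PI False by (auto simp: E_def)
      with inputs_split(3)[of x] x show "x \<in> {z(i := a)} \<inter> set_pmf ?C" by auto
    next
      fix x assume "x \<in> {z(i := a)} \<inter> set_pmf ?C"
      then show "x \<in> (\<lambda>x. restrict x ({1..n} - {i})) -` {z} \<inter> set_pmf ?C"
        using z by (auto simp: other_inputs_def PiE_iff extensional_def fun_eq_iff)
    qed
    also have "measure ?C ({z(i := a)} \<inter> set_pmf ?C) = pmf ?C (z(i := a))"
      by (simp add: measure_Int_set_pmf measure_pmf_single)
    also have "\<dots> = pmf P (z(i := a)) / measure P (E a)"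
      using False by (simp add: pmf_cond E_def)
    finally have "pmf (K a) z = pmf P (z(i := a)) / measure P (E a)" .
    moreover have "measure P (E a) \<noteq> 0" using False by (simp add: measure_pmf_zero_iff)
    ultimately show ?thesis by (simp add: qa)
  qed
  with q K show ?thesis by blast
qed

lemma induced_channel_exists:
  assumes K: "K \<in> channels A Z"
  shows "\<exists>W\<in>channels A Y. \<forall>a\<in>A. \<forall>y\<in>Y. pmf (W a) y = (\<Sum>z\<in>Z. pmf (p (z(i := a))) y * pmf (K a) z)"
proof (intro bexI ballI)
  let ?W = "\<lambda>a\<in>A. bind_pmf (K a) (\<lambda>z. p (z(i := a)))"
  have KZ: "set_pmf (K a) \<subseteq> Z" if "a \<in> A" for a using K that by (auto simp: channels_def dists_def)
  show "?W \<in> channels A Y"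
    using KZ p_dists unfolding channels_def dists_def by fastforce
  show "pmf (?W a) y = (\<Sum>z\<in>Z. pmf (p (z(i := a))) y * pmf (K a) z)" if "a \<in> A" for a y
    using that KZ[of a] finite_Z by (simp add: pmf_bind_finite mult.commute)
qed

section \<open>The channel sets Q_i and S_i\<close>

lemma Q_channels_iff:
  "W \<in> Q \<longleftrightarrow> W \<in> channels A Y \<and> (\<exists>K\<in>channels A Z. \<forall>a\<in>A. \<forall>y\<in>Y.
     pmf (W a) y = (\<Sum>z\<in>Z. pmf (p (z(i := a))) y * pmf (K a) z))"
  by (simp add: Q_channels_def conditionals_eq)

text \<open>A distribution on \<open>Y\<close> is determined by its values on \<open>Y\<close>, so
  equality of rows on \<open>Y\<close> is equality of rows. The product form shows that the rows are
  chosen independently and that \<open>S\<close> is finite and nonempty.\<close>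

lemma S_channels_eq: "S = (\<Pi>\<^sub>E a\<in>A. (\<lambda>z. p (z(i := a))) ` Z)"
proof (intro equalityI subsetI)
  fix W assume W: "W \<in> S"
  have "W a \<in> (\<lambda>z. p (z(i := a))) ` Z" if a: "a \<in> A" for a
  proof -
    obtain z where z: "z \<in> Z" "\<forall>y\<in>Y. pmf (W a) y = pmf (p (z(i := a))) y"
      using W a by (auto simp: S_channels_def)
    moreover have "W a \<in> dists Y" using W a by (auto simp: S_channels_def channels_def)
    ultimately have "W a = p (z(i := a))" using p_dists a by (intro pmf_eqI_dists) auto
    with z show ?thesis by blast
  qed
  with W show "W \<in> (\<Pi>\<^sub>E a\<in>A. (\<lambda>z. p (z(i := a))) ` Z)" by (auto simp: S_channels_def channels_def PiE_iff)
next
  fix W assume W: "W \<in> (\<Pi>\<^sub>E a\<in>A. (\<lambda>z. p (z(i := a))) ` Z)"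
  then have "W \<in> channels A Y" using p_dists by (fastforce simp: channels_def PiE_iff)
  moreover have "\<exists>z\<in>Z. \<forall>y\<in>Y. pmf (W a) y = pmf (p (z(i := a))) y" if "a \<in> A" for a
    using PiE_mem[OF W that] by auto
  ultimately show "W \<in> S" by (simp add: S_channels_def)
qed

lemma finite_S: "finite S" and S_nonempty: "S \<noteq> {}"
  using finite_A finite_Z Z_nonempty by (auto simp: S_channels_eq PiE_eq_empty_iff intro!: finite_PiE)

text \<open>Point masses at the selected completions serve as the conditional distribution.\<close>

lemma S_subset_Q: "S \<subseteq> Q"
proof
  fix W assume W: "W \<in> S"
  then obtain z where z: "\<And>a. a \<in> A \<Longrightarrow> z a \<in> Z \<and> W a = p ((z a)(i := a))"
    unfolding S_channels_eq PiE_iff image_iff by metis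
  have "(\<lambda>a\<in>A. return_pmf (z a)) \<in> channels A Z"
    using z by (auto simp: channels_def dists_def)
  moreover have "pmf (W a) y = (\<Sum>z'\<in>Z. pmf (p (z'(i := a))) y * pmf ((\<lambda>a\<in>A. return_pmf (z a)) a) z')"
    if a: "a \<in> A" for a y
  proof -
    have "(\<Sum>z'\<in>Z. pmf (p (z'(i := a))) y * pmf (return_pmf (z a)) z')
        = (\<Sum>z'\<in>Z. if z' = z a then pmf (p (z'(i := a))) y else 0)"
      by (intro sum.cong refl) (auto simp: pmf_return indicator_def)
    then show ?thesis using z[OF a] a finite_Z by simp
  qed
  moreover have "W \<in> channels A Y" using W by (simp add: S_channels_def)
  ultimately show "W \<in> Q" unfolding Q_channels_iff by blast
qed

text \<open>The selectors \<open>s\<close> are drawn with independent entries, the entry at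
  \<open>a\<close> having law \<open>K a\<close>. Averaging the channels \<open>V s\<close> under
  this product law gives \<open>W\<close>, since row \<open>a\<close> of \<open>V s\<close> depends
  only on \<open>s a\<close>.\<close>

lemma Q_convex_combination:
  assumes W: "W \<in> Q"
  shows "convex_combination_of A Y S W"
proof -
  obtain K where K: "K \<in> channels A Z"
    and WK: "\<And>a y. a \<in> A \<Longrightarrow> y \<in> Y \<Longrightarrow> pmf (W a) y = (\<Sum>z\<in>Z. pmf (p (z(i := a))) y * pmf (K a) z)"
    using W by (auto simp: Q_channels_iff)
  let ?F = "A \<rightarrow>\<^sub>E Z"
  define w where "w s = (\<Prod>a\<in>A. pmf (K a) (s a))" for s
  define V where "V s = (\<lambda>a\<in>A. p ((s a)(i := a)))" for s
  \<comment> \<open>Different selectors may give the same channel, so the coefficient of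
    \<open>U\<close> collects the weights of its whole fibre.\<close>
  define c where "c U = (\<Sum>s\<in>{s. s \<in> ?F \<and> V s = U}. w s)" for U
  have fin: "finite ?F" using finite_A finite_Z by (simp add: finite_PiE)
  have V: "V ` ?F \<subseteq> S" by (auto simp: S_channels_eq V_def PiE_iff)
  have Ksum: "(\<Sum>z\<in>Z. pmf (K a) z) = 1" if "a \<in> A" for a
    using sum_pmf_channel[OF finite_Z K that] .
  have regroup: "(\<Sum>U\<in>S. c U * g U) = (\<Sum>s\<in>?F. w s * g (V s))" for g :: "_ \<Rightarrow> real"
  proof -
    have "(\<Sum>U\<in>S. c U * g U) = (\<Sum>U\<in>S. \<Sum>s\<in>{s. s \<in> ?F \<and> V s = U}. w s * g (V s))"
      unfolding c_def sum_distrib_right by (intro sum.cong refl) auto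
    also have "\<dots> = (\<Sum>s\<in>?F. w s * g (V s))"
      by (rule sum.group[OF fin finite_S V])
    finally show ?thesis .
  qed
  \<comment> \<open>The marginal of the product law at \<open>a\<close> is \<open>K a\<close>.
    Absorbing \<open>g\<close> into the factor at \<open>a\<close> lets the sum over selectors
    factor into a product of sums, and all other factors are 1.\<close>
  have expect: "(\<Sum>s\<in>?F. w s * g (s a)) = (\<Sum>z\<in>Z. pmf (K a) z * g z)"
    if a: "a \<in> A" for a and g :: "_ \<Rightarrow> real"
  proof -
    have "(\<Sum>s\<in>?F. w s * g (s a)) = (\<Sum>s\<in>?F. \<Prod>a'\<in>A. pmf (K a') (s a') * (if a' = a then g (s a') else 1))"
      using a finite_A by (simp add: w_def prod.distrib)
    also have "\<dots> = (\<Prod>a'\<in>A. \<Sum>z\<in>Z. pmf (K a') z * (if a' = a then g z else 1))"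
      using finite_A finite_Z by (subst prod_sum_PiE) auto
    also have "\<dots> = (\<Prod>a'\<in>A. if a' = a then \<Sum>z\<in>Z. pmf (K a) z * g z else 1)"
      using Ksum by (intro prod.cong refl) auto
    finally show ?thesis using a finite_A by simp
  qed
  obtain a0 where a0: "a0 \<in> A" using A_nonempty by blast
  show ?thesis
    unfolding convex_combination_of_def
  proof (intro exI conjI ballI)
    show "finite S" "S \<subseteq> S" by (simp_all add: finite_S)
    show "0 \<le> c U" for U by (auto simp: c_def w_def intro!: sum_nonneg prod_nonneg)
    \<comment> \<open>The total weight is the expectation of the constant 1, read off at an
      arbitrary coordinate \<open>a0\<close>.\<close>
    show "(\<Sum>U\<in>S. c U) = 1"
      using regroup[of "\<lambda>_. 1"] expect[OF a0, of "\<lambda>_. 1"] Ksum[OF a0] by simp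
    show "pmf (W a) y = (\<Sum>U\<in>S. c U * pmf (U a) y)" if "a \<in> A" "y \<in> Y" for a y
      using regroup[of "\<lambda>U. pmf (U a) y"] expect[OF that(1), of "\<lambda>z. pmf (p (z(i := a))) y"] that
      by (simp add: WK V_def mult.commute)
  qed
qed

section \<open>Comparing capacities over Q_i, S_i and the joint inputs\<close>

lemma channels_Q: "W \<in> Q \<Longrightarrow> W \<in> channels A Y"
  by (simp add: Q_channels_def)

lemma channel_capacity_attained:
  assumes W: "W \<in> Q" and b: "b > 1"
  shows "\<exists>q\<in>dists A. channel_capacity b A Y W = info_sum b A Y q W"
  unfolding channel_capacity_def
  using has_maximum_channel_info[OF finite_A A_nonempty finite_Y channels_Q[OF W] b]
  by (rule has_maximumE)
     (auto simp: channel_info_eq_info_sum[OF finite_A finite_Y _ channels_Q[OF W] b])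

lemma info_sum_le_channel_capacity:
  assumes W: "W \<in> Q" and q: "q \<in> dists A" and b: "b > 1"
  shows "info_sum b A Y q W \<le> channel_capacity b A Y W"
  unfolding channel_capacity_def
  using has_maximum_channel_info[OF finite_A A_nonempty finite_Y channels_Q[OF W] b]
  by (rule has_maximumE)
     (use q in \<open>simp add: channel_info_eq_info_sum[OF finite_A finite_Y q channels_Q[OF W] b, symmetric]\<close>)

text \<open>Let \<open>V\<close> have the largest capacity in the finite set \<open>S\<close>. For
  \<open>W\<close> in \<open>Q\<close> with optimal input \<open>q\<close>, convexity bounds the
  capacity of \<open>W\<close> by an average of the informations of members of \<open>S\<close> at
  this same \<open>q\<close>, and each of these is at most the capacity of \<open>V\<close>.\<close>

lemma capacity_attained_on_S:
  assumes b: "b > 1"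
  shows "\<exists>V\<in>S. \<forall>W\<in>Q. channel_capacity b A Y W \<le> channel_capacity b A Y V"
proof -
  obtain V where V: "V \<in> S" "\<And>U. U \<in> S \<Longrightarrow> channel_capacity b A Y U \<le> channel_capacity b A Y V"
    using has_maximum_finite[OF finite_S S_nonempty, of "channel_capacity b A Y"] by (auto simp: has_maximum_def)
  have "channel_capacity b A Y W \<le> channel_capacity b A Y V" if W: "W \<in> Q" for W
  proof -
    obtain q where q: "q \<in> dists A" "channel_capacity b A Y W = info_sum b A Y q W"
      using channel_capacity_attained[OF W b] by (elim bexE)
    obtain T c where T: "finite T" "T \<subseteq> S" and c: "\<And>U. U \<in> T \<Longrightarrow> 0 \<le> c U" "(\<Sum>U\<in>T. c U) = 1"
      and Wc: "\<And>a y. a \<in> A \<Longrightarrow> y \<in> Y \<Longrightarrow> pmf (W a) y = (\<Sum>U\<in>T. c U * pmf (U a) y)"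
      using Q_convex_combination[OF W] unfolding convex_combination_of_def by blast
    have "channel_capacity b A Y W \<le> (\<Sum>U\<in>T. c U * info_sum b A Y q U)"
      unfolding q(2) by (rule info_sum_convex[OF finite_A T(1) b c(1) Wc])
    also have "\<dots> \<le> (\<Sum>U\<in>T. c U * channel_capacity b A Y V)"
    proof (intro sum_mono mult_left_mono c(1))
      fix U assume "U \<in> T"
      then have U: "U \<in> S" using T by blast
      then have "info_sum b A Y q U \<le> channel_capacity b A Y U"
        using S_subset_Q b q(1) by (intro info_sum_le_channel_capacity) auto
      with V(2)[OF U] show "info_sum b A Y q U \<le> channel_capacity b A Y V" by simp
    qed
    also have "\<dots> = channel_capacity b A Y V" by (simp add: sum_distrib_right[symmetric] c(2))
    finally show ?thesis .
  qed
  with V(1) show ?thesis by blast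
qed

text \<open>Disintegrating \<open>P\<close> into \<open>q\<close> and \<open>K\<close>, and
  averaging \<open>p\<close> over \<open>K\<close>, presents (X_i, Y) as input and output of a
  channel in \<open>Q\<close>.\<close>

lemma coord_info_le_capacity:
  assumes P: "P \<in> dists (inputs n Xs)" and b: "b > 1"
  shows "\<exists>W\<in>Q. coord_info b n Xs Y p i P \<le> channel_capacity b A Y W"
proof -
  obtain q K where q: "q \<in> dists A" and K: "K \<in> channels A Z"
    and PK: "\<And>a z. a \<in> A \<Longrightarrow> z \<in> Z \<Longrightarrow> pmf P (z(i := a)) = pmf q a * pmf (K a) z"
    using conditional_exists[OF P] by blast
  obtain W where W: "W \<in> channels A Y"
    and WK: "\<And>a y. a \<in> A \<Longrightarrow> y \<in> Y \<Longrightarrow> pmf (W a) y = (\<Sum>z\<in>Z. pmf (p (z(i := a))) y * pmf (K a) z)"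
    using induced_channel_exists[OF K] by blast
  have WQ: "W \<in> Q" using W K WK by (auto simp: Q_channels_iff)
  have "coord_info b n Xs Y p i P = info_sum b A Y q W"
    by (rule coord_info_eq_info_sum[OF P q W b]) (simp add: PK WK sum_distrib_left mult_ac)
  with info_sum_le_channel_capacity[OF WQ q b] WQ show ?thesis by auto
qed

text \<open>The converse direction: an optimal input law for \<open>W\<close> is glued to a
  conditional distribution that induces \<open>W\<close>.\<close>

lemma coord_info_attains_capacity:
  assumes W: "W \<in> Q" and b: "b > 1"
  shows "\<exists>P\<in>dists (inputs n Xs). coord_info b n Xs Y p i P = channel_capacity b A Y W"
proof -
  obtain q where q: "q \<in> dists A" "channel_capacity b A Y W = info_sum b A Y q W"
    using channel_capacity_attained[OF W b] by (elim bexE)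
  obtain K where K: "K \<in> channels A Z"
    and WK: "\<And>a y. a \<in> A \<Longrightarrow> y \<in> Y \<Longrightarrow> pmf (W a) y = (\<Sum>z\<in>Z. pmf (p (z(i := a))) y * pmf (K a) z)"
    using W by (auto simp: Q_channels_iff)
  obtain P where P: "P \<in> dists (inputs n Xs)"
    and PK: "\<And>a z. a \<in> A \<Longrightarrow> z \<in> Z \<Longrightarrow> pmf P (z(i := a)) = pmf q a * pmf (K a) z"
    using joint_distribution_exists[OF q(1) K] by blast
  have "coord_info b n Xs Y p i P = info_sum b A Y q W"
    by (rule coord_info_eq_info_sum[OF P q(1) channels_Q[OF W] b])
       (simp add: PK WK sum_distrib_left mult_ac)
  with P q(2) show ?thesis by auto
qed

end

section \<open>Maximising over the coordinates\<close>

theorem theorem1: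
  fixes n :: nat and Xs :: "nat \<Rightarrow> 'a set" and Y :: "'y set"
    and p :: "(nat \<Rightarrow> 'a) \<Rightarrow> 'y pmf" and b :: real
  assumes "n \<ge> 1"
    and "\<And>i. i \<in> {1..n} \<Longrightarrow> finite (Xs i)"
    and "\<And>i. i \<in> {1..n} \<Longrightarrow> Xs i \<noteq> {}"
    and "finite Y"
    and "p \<in> channels (inputs n Xs) Y"
    and "b > 1"
  shows
    "(\<forall>i\<in>{1..n}. S_channels n Xs Y p i \<subseteq> Q_channels n Xs Y p i)
     \<and> (\<forall>i\<in>{1..n}. \<forall>W\<in>Q_channels n Xs Y p i.
           convex_combination_of (Xs i) Y (S_channels n Xs Y p i) W)
     \<and> has_maximum ({1..n} \<times> dists (inputs n Xs)) (\<lambda>(i, P). coord_info b n Xs Y p i P)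
     \<and> (\<forall>C\<in>{Q_channels n Xs Y p, S_channels n Xs Y p}.
           (\<forall>i\<in>{1..n}. \<forall>W\<in>C i. has_maximum (dists (Xs i)) (\<lambda>q. channel_info b (Xs i) Y q W))
         \<and> (\<forall>i\<in>{1..n}. has_maximum (C i)
               (\<lambda>W. maximum (dists (Xs i)) (\<lambda>q. channel_info b (Xs i) Y q W)))
         \<and> has_maximum {1..n} (\<lambda>i. maximum (C i)
               (\<lambda>W. maximum (dists (Xs i)) (\<lambda>q. channel_info b (Xs i) Y q W))))
     \<and> individual_capacity b n Xs Y p
         = maximum ({1..n} \<times> dists (inputs n Xs)) (\<lambda>(i, P). coord_info b n Xs Y p i P)
     \<and> individual_capacity b n Xs Y p
         = maximum {1..n} (\<lambda>i. maximum (Q_channels n Xs Y p i)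
             (\<lambda>W. maximum (dists (Xs i)) (\<lambda>q. channel_info b (Xs i) Y q W)))
     \<and> individual_capacity b n Xs Y p
         = maximum {1..n} (\<lambda>i. maximum (S_channels n Xs Y p i)
             (\<lambda>W. maximum (dists (Xs i)) (\<lambda>q. channel_info b (Xs i) Y q W)))"
proof -
  let ?Q = "Q_channels n Xs Y p" and ?S = "S_channels n Xs Y p"
  let ?cap = "\<lambda>i. channel_capacity b (Xs i) Y"
  let ?X = "{1..n} \<times> dists (inputs n Xs)"
  let ?I = "\<lambda>(i, P). coord_info b n Xs Y p i P"
  have loc: "channel_coordinate n Xs Y p i" if "i \<in> {1..n}" for i
    using assms that by unfold_locales auto
  have SQ: "?S i \<subseteq> ?Q i" if "i \<in> {1..n}" for i
    using channel_coordinate.S_subset_Q[OF loc[OF that]] .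
  have "\<exists>V\<in>?S i. \<forall>W\<in>?Q i. ?cap i W \<le> ?cap i V" if "i \<in> {1..n}" for i
    using channel_coordinate.capacity_attained_on_S[OF loc[OF that] assms(6)] .
  then obtain V where V: "\<And>i. i \<in> {1..n} \<Longrightarrow> V i \<in> ?S i"
    and V_max: "\<And>i W. i \<in> {1..n} \<Longrightarrow> W \<in> ?Q i \<Longrightarrow> ?cap i W \<le> ?cap i (V i)"
    by metis
  have "has_maximum {1..n} (\<lambda>i. ?cap i (V i))"
    using assms(1) by (intro has_maximum_finite) auto
  \<comment> \<open>All maxima of the claim share one value, the capacity of the best selected
    channel \<open>V i0\<close>; \<open>P0\<close> realises it as an information of a random
    vector.\<close>
  then obtain i0 where i0: "i0 \<in> {1..n}" "\<And>i. i \<in> {1..n} \<Longrightarrow> ?cap i (V i) \<le> ?cap i0 (V i0)"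
    by (auto simp: has_maximum_def)
  obtain P0 where P0: "P0 \<in> dists (inputs n Xs)" "coord_info b n Xs Y p i0 P0 = ?cap i0 (V i0)"
    using channel_coordinate.coord_info_attains_capacity[OF loc[OF i0(1)] _ assms(6)] V i0(1) SQ by blast
  have I_le: "?I t \<le> ?I (i0, P0)" if t: "t \<in> ?X" for t
  proof -
    obtain i P where iP: "t = (i, P)" "i \<in> {1..n}" "P \<in> dists (inputs n Xs)" using t by auto
    obtain W where W: "W \<in> ?Q i" "coord_info b n Xs Y p i P \<le> ?cap i W"
      using channel_coordinate.coord_info_le_capacity[OF loc[OF iP(2)] iP(3) assms(6)] by blast
    have "?cap i W \<le> ?cap i0 (V i0)" using V_max[OF iP(2) W(1)] i0(2)[OF iP(2)] by linarith
    with W(2) show ?thesis by (simp add: iP(1) P0(2))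
  qed
  have I_max: "has_maximum ?X ?I"
    unfolding has_maximum_def using I_le i0(1) P0(1) by (intro bexI[of _ "(i0, P0)"]) auto
  have cap: "individual_capacity b n Xs Y p = ?cap i0 (V i0)"
    unfolding individual_capacity_def using maximum_eqI[of "(i0, P0)" ?X ?I] I_le i0(1) P0 by auto
  \<comment> \<open>Both families are treated at once, using only that \<open>C i\<close> lies
    inside Q_i and contains \<open>V i\<close>, whose capacity is maximal on Q_i.\<close>
  have C: "(\<forall>i\<in>{1..n}. \<forall>W\<in>C i. has_maximum (dists (Xs i)) (\<lambda>q. channel_info b (Xs i) Y q W))
      \<and> (\<forall>i\<in>{1..n}. has_maximum (C i) (?cap i))
      \<and> has_maximum {1..n} (\<lambda>i. maximum (C i) (?cap i))
      \<and> individual_capacity b n Xs Y p = maximum {1..n} (\<lambda>i. maximum (C i) (?cap i))"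
    if "C \<in> {?Q, ?S}" for C
  proof -
    have CQ: "C i \<subseteq> ?Q i" and VC: "V i \<in> C i" if "i \<in> {1..n}" for i
      using that SQ[of i] V[of i] \<open>C \<in> {?Q, ?S}\<close> by auto
    have info_max: "has_maximum (dists (Xs i)) (\<lambda>q. channel_info b (Xs i) Y q W)"
      if "i \<in> {1..n}" "W \<in> C i" for i W
      using assms that CQ[of i]
      by (intro has_maximum_channel_info) (auto simp: Q_channels_def)
    have C_max: "has_maximum (C i) (?cap i)" if "i \<in> {1..n}" for i
      unfolding has_maximum_def using that CQ VC V_max by blast
    have maxC: "maximum (C i) (?cap i) = ?cap i (V i)" if "i \<in> {1..n}" for i
      by (rule maximum_eqI) (use that CQ VC V_max in blast)+
    have "has_maximum {1..n} (\<lambda>i. maximum (C i) (?cap i))"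
      using assms(1) by (intro has_maximum_finite) auto
    moreover have "maximum {1..n} (\<lambda>i. maximum (C i) (?cap i)) = maximum (C i0) (?cap i0)"
      by (rule maximum_eqI) (use i0 maxC in auto)
    ultimately show ?thesis using info_max C_max maxC[OF i0(1)] cap by simp
  qed
  have conv: "convex_combination_of (Xs i) Y (?S i) W" if "i \<in> {1..n}" "W \<in> ?Q i" for i W
    using channel_coordinate.Q_convex_combination[OF loc[OF that(1)] that(2)] .
  show ?thesis
    unfolding channel_capacity_def[symmetric]
    using SQ conv I_max C[of ?Q] C[of ?S] by (simp add: individual_capacity_def)
qed

end
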